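(* Let $n\ge 1$, let $\alpha,\beta\in I_n$, and put $\lambda=\sigma(\alpha)$, $\mu=\sigma(\beta)$. For every semistandard set-valued shifted tableau $S$ on $\mu$ of shape $\lambda$ and every entry $x$ of $S$, the factor $$\frac{1}{t_{\beta'(x)}\,t_{\beta'(z(x))}}-1\in R(T)$$ is of the form $e^{\theta}-1$ with $\theta$ a positive root with respect to the Borel subgroup $B^-$. Likewise, for every semistandard Young shifted tableau $S$ on $\mu$ of shape $\lambda$ and every entry $x$ of $S$, the factor $$-t_{\beta'(x)}-t_{\beta'(z(x))}$$ is a positive root $\theta$ with respect to the Borel subgroup $B^-$.
   Context: **Group.** Let $J$ be the antidiagonal $2n\times 2n$ matrix whose top $n$ antidiagonal entries are $1$ and whose bottom $n$ antidiagonal entries are $-1$. $G=Sp_{2n}(\mathbb{C})$ is the group of $2n\times2n$ complex matrices preserving the form $\langle v,w\rangle=v^tJw$; $T$ and $B^-$ are its subgroups of diagonal and lower triangular matrices, so $T=\{\mathrm{diag}(s_1,\ldots,s_n,s_n^{-1},\ldots,s_1^{-1})\mid s_k\in\mathbb{C}^*\}$. A positive root with respect to $B^-$ is a nonzero weight of $T$ on the Lie algebra of $B^-$. $R(T)=\mathbb{C}[t_1^{\pm1},\ldots,t_n^{\pm1}]$ is the representation ring, with $t_k$ the character $\mathrm{diag}(s_1,\ldots,s_n,s_n^{-1},\ldots,s_1^{-1})\mapsto s_k$; additively, $t_k$ denotes the corresponding weight in $\mathfrak{t}^*$, i.e. $\mathrm{diag}(s_1,\ldots,s_n,-s_n,\ldots,-s_1)\mapsto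 s_k$, and $e^\theta$ is the character of $T$ with weight $\theta$. For $k\in\{1,\ldots,2n\}$ put $\overline{k}=2n+1-k$; for $k=1,\ldots,n$, $t_{\overline{k}}$ means $t_k^{-1}$ in $R(T)$ and $-t_k$ in additive notation. **Indexing.** $I_n$ is the set of $n$-element subsets $\alpha=\{\alpha(1)<\cdots<\alpha(n)\}$ of $\{1,\ldots,2n\}$ containing exactly one of $k,\overline{k}$ for each $k$. For $\beta\in I_n$, $\beta'=\{1,\ldots,2n\}\setminus\beta=\{\beta'(1)<\cdots<\beta'(n)\}$. **Partitions.** A partition is a weakly decreasing list of nonnegative integers, up to adding zeros. It is strict if its nonzero parts are distinct. Let $\pi(\{\gamma(1)<\cdots<\gamma(k)\})=(\gamma(k)-k,\ldots,\gamma(1)-1)$, and $\rho(\lambda_1,\ldots,\lambda_k)=(\lambda_1,\lambda_2-1,\ldots,\lambda_l-l+1)$ where $l$ is maximal with $\lambda_l-l+1\ge0$. Put $\sigma=\rho\circ\pi$; it is a bijection from $I_n$ to the strict partitions with first part at most $n$. **Tableaux.** The shifted diagram of a strict partition $\lambda$ (of shape $\lambda$) has in row $i$ exactly $\lambda_i$ boxes, in columns $i,i+1,\ldots,i+\lambda_i-1$. A set-valued shifted tableau $S$ of shape $\lambda$ assigns a nonempty set of positive integers to each box of this diagram. Its entries are the integers in the boxes; occurrences in different boxes count as distinct entries. For an entry $x$ in the box in row $r(x)$ and column $c(x)$, put $z(x)=x+c(x)-r(x)$. $S$ is a Young shifted tableau if each box has exactly one entry. $S$ is semistandard if all entries of any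 box are $\le$ all entries of the box to its right and $<$ all entries of the box below it. For a strict partition $\mu=(\mu_1,\ldots,\mu_h)$, $S$ is said to be on $\mu$ if every entry $x$ of $S$ satisfies $x\le h$ and $z(x)\le\mu_x+x-1$. *)

theory Defs
  imports
    Complex_Main
    "HOL-Library.FuncSet"
    "Jordan_Normal_Form.Matrix"
    "Jordan_Normal_Form.Gauss_Jordan_Elimination"
begin

text \<open>
  Matrix rows and columns are numbered from 0 in the matrix library, whereas the indices of the
  characters, sets, partitions and diagrams below are numbered from 1.
\<close>

section \<open>The symplectic group, its torus and its Borel subgroup\<close>

definition J_mat :: "nat \<Rightarrow> complex mat" where
  "J_mat n = mat (2 * n) (2 * n)
     (\<lambda>(i, j). if i + j + 1 = 2 * n then (if i < n then 1 else - 1) else 0)"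

definition sp_form :: "nat \<Rightarrow> complex vec \<Rightarrow> complex vec \<Rightarrow> complex" where
  "sp_form n v w = v \<bullet> (J_mat n *\<^sub>v w)"

definition Sp :: "nat \<Rightarrow> complex mat set" where
  "Sp n = {g \<in> carrier_mat (2 * n) (2 * n).
     \<forall>v \<in> carrier_vec (2 * n). \<forall>w \<in> carrier_vec (2 * n).
       sp_form n (g *\<^sub>v v) (g *\<^sub>v w) = sp_form n v w}"

definition torus :: "nat \<Rightarrow> complex mat set" where
  "torus n = {g \<in> Sp n. diagonal_mat g}"

definition borel_minus :: "nat \<Rightarrow> complex mat set" where
  "borel_minus n = {g \<in> Sp n. \<forall>i < 2 * n. \<forall>j < 2 * n. i < j \<longrightarrow> g $$ (i, j) = 0}"


section \<open>Lie algebras\<close>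

text \<open>
  \<open>curve_through_one N K \<gamma> X\<close>: \<open>\<gamma>\<close> is a real curve in the matrix group \<open>K\<close> with \<open>\<gamma>(0) = 1\<close> and
  (entrywise) \<open>\<gamma>'(0) = X\<close>. The Lie algebra of \<open>K\<close> is its tangent space at the identity.
\<close>

definition curve_through_one ::
    "nat \<Rightarrow> complex mat set \<Rightarrow> (real \<Rightarrow> complex mat) \<Rightarrow> complex mat \<Rightarrow> bool" where
  "curve_through_one N K \<gamma> X \<longleftrightarrow>
     X \<in> carrier_mat N N \<and> (\<forall>u. \<gamma> u \<in> K) \<and> \<gamma> 0 = 1\<^sub>m N \<and>
     (\<forall>i < N. \<forall>j < N. ((\<lambda>u. \<gamma> u $$ (i, j)) has_vector_derivative X $$ (i, j)) (at 0))"

definition lie_algebra :: "nat \<Rightarrow> complex mat set \<Rightarrow> complex mat set" where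
  "lie_algebra N K = {X. \<exists>\<gamma>. curve_through_one N K \<gamma> X}"

abbreviation lie_torus :: "nat \<Rightarrow> complex mat set" where
  "lie_torus n \<equiv> lie_algebra (2 * n) (torus n)"

abbreviation lie_borel_minus :: "nat \<Rightarrow> complex mat set" where
  "lie_borel_minus n \<equiv> lie_algebra (2 * n) (borel_minus n)"

definition lie_torus_dual :: "nat \<Rightarrow> (complex mat \<Rightarrow> complex) set" where
  "lie_torus_dual n = {\<theta> \<in> extensional (lie_torus n).
     (\<forall>H \<in> lie_torus n. \<forall>H' \<in> lie_torus n. \<theta> (H + H') = \<theta> H + \<theta> H') \<and>
     (\<forall>H \<in> lie_torus n. \<forall>c. \<theta> (c \<cdot>\<^sub>m H) = c * \<theta> H)}"


section \<open>Characters, weights and positive roots\<close>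

definition bar :: "nat \<Rightarrow> nat \<Rightarrow> nat" where
  "bar n k = 2 * n + 1 - k"

text \<open>
  \<open>t_char n k\<close> and \<open>t_weight n k\<close> are \<open>t\<^sub>k\<close> in multiplicative and in additive notation, for
  \<open>1 \<le> k \<le> 2n\<close>. Functions on the torus and on its Lie algebra are extensional, so that equality
  of such functions means agreement on the torus and on its Lie algebra, respectively.
\<close>

definition t_char :: "nat \<Rightarrow> nat \<Rightarrow> complex mat \<Rightarrow> complex" where
  "t_char n k = (\<lambda>s\<in>torus n.
     if k \<le> n then s $$ (k - 1, k - 1) else inverse (s $$ (bar n k - 1, bar n k - 1)))"

definition t_weight :: "nat \<Rightarrow> nat \<Rightarrow> complex mat \<Rightarrow> complex" where
  "t_weight n k = (\<lambda>H\<in>lie_torus n.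
     if k \<le> n then H $$ (k - 1, k - 1) else - (H $$ (bar n k - 1, bar n k - 1)))"

text \<open>
  \<open>R(T)\<close>: since the \<open>t\<^sub>k\<close> are characters of \<open>T\<close>, the ring of Laurent polynomials in
  \<open>t\<^sub>1, \<dots>, t\<^sub>n\<close> is taken as a ring of functions on \<open>T\<close>; this loses nothing because distinct
  Laurent monomials are distinct, hence linearly independent, characters.
\<close>

definition rep_ring :: "nat \<Rightarrow> (complex mat \<Rightarrow> complex) set" where
  "rep_ring n = {f. \<exists>(E :: (nat \<Rightarrow> int) set) (c :: (nat \<Rightarrow> int) \<Rightarrow> complex). finite E \<and>
     f = (\<lambda>s\<in>torus n. \<Sum>m\<in>E. c m * (\<Prod>k = 1..n. t_char n k s powi m k))}"

definition torus_characters :: "nat \<Rightarrow> (complex mat \<Rightarrow> complex) set" where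
  "torus_characters n = {\<chi> \<in> rep_ring n.
     (\<forall>s \<in> torus n. \<chi> s \<noteq> 0) \<and>
     (\<forall>s \<in> torus n. \<forall>s' \<in> torus n. \<chi> (s * s') = \<chi> s * \<chi> s')}"

text \<open>The weight of a character is its differential at the identity.\<close>

definition has_weight :: "nat \<Rightarrow> (complex mat \<Rightarrow> complex) \<Rightarrow> (complex mat \<Rightarrow> complex) \<Rightarrow> bool" where
  "has_weight n \<chi> \<theta> \<longleftrightarrow>
     \<chi> \<in> torus_characters n \<and> \<theta> \<in> lie_torus_dual n \<and>
     (\<forall>\<gamma> H. curve_through_one (2 * n) (torus n) \<gamma> H \<longrightarrow>
        ((\<lambda>u. \<chi> (\<gamma> u)) has_vector_derivative \<theta> H) (at 0))"

definition exp_weight :: "nat \<Rightarrow> (complex mat \<Rightarrow> complex) \<Rightarrow> complex mat \<Rightarrow> complex" where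
  "exp_weight n \<theta> = (THE \<chi>. has_weight n \<chi> \<theta>)"

definition adjoint_action :: "complex mat \<Rightarrow> complex mat \<Rightarrow> complex mat" where
  "adjoint_action s X = s * X * the (mat_inverse s)"

text \<open>Weights of \<open>T\<close>, acting by conjugation, on a space \<open>V\<close> of matrices.\<close>

definition weight_on :: "nat \<Rightarrow> complex mat set \<Rightarrow> (complex mat \<Rightarrow> complex) \<Rightarrow> bool" where
  "weight_on n V \<theta> \<longleftrightarrow>
     (\<exists>\<chi>. has_weight n \<chi> \<theta> \<and>
       (\<exists>X \<in> V. X \<noteq> 0\<^sub>m (2 * n) (2 * n) \<and>
          (\<forall>s \<in> torus n. adjoint_action s X = \<chi> s \<cdot>\<^sub>m X)))"

definition positive_root :: "nat \<Rightarrow> (complex mat \<Rightarrow> complex) \<Rightarrow> bool" where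
  "positive_root n \<theta> \<longleftrightarrow>
     weight_on n (lie_borel_minus n) \<theta> \<and> \<theta> \<noteq> (\<lambda>H\<in>lie_torus n. 0)"


section \<open>Index sets and partitions\<close>

definition index_sets :: "nat \<Rightarrow> nat set set" where
  "index_sets n = {\<alpha>. \<alpha> \<subseteq> {1..2 * n} \<and> card \<alpha> = n \<and>
     (\<forall>k \<in> {1..2 * n}. (k \<in> \<alpha>) \<noteq> (bar n k \<in> \<alpha>))}"

text \<open>\<open>elt \<gamma> i\<close> is the \<open>i\<close>-th smallest element \<open>\<gamma>(i)\<close> of a finite set, for \<open>1 \<le> i \<le> card \<gamma>\<close>.\<close>

definition elt :: "nat set \<Rightarrow> nat \<Rightarrow> nat" where
  "elt \<gamma> i = sorted_list_of_set \<gamma> ! (i - 1)"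

definition index_compl :: "nat \<Rightarrow> nat set \<Rightarrow> nat set" where
  "index_compl n \<beta> = {1..2 * n} - \<beta>"

text \<open>
  Partitions are lists of their parts. Reading parts with \<open>part\<close>, which is 0 beyond the end of the
  list, makes the notions below independent of trailing zeros.
\<close>

definition part :: "nat list \<Rightarrow> nat \<Rightarrow> nat" where
  "part lam i = (if 1 \<le> i \<and> i \<le> length lam then lam ! (i - 1) else 0)"

definition pi_map :: "nat set \<Rightarrow> nat list" where
  "pi_map \<gamma> = map (\<lambda>i. elt \<gamma> i - i) (rev [1..<card \<gamma> + 1])"

text \<open>
  The condition \<open>lam\<^sub>l - l + 1 \<ge> 0\<close> is written without subtraction. No subtraction of natural
  numbers is truncated here on partitions.
\<close>

definition rho_map :: "nat list \<Rightarrow> nat list" where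
  "rho_map lam = map (\<lambda>i. part lam i + 1 - i)
     [1..<(GREATEST l. 1 \<le> l \<and> l \<le> part lam l + 1) + 1]"

definition sigma_map :: "nat set \<Rightarrow> nat list" where
  "sigma_map \<gamma> = rho_map (pi_map \<gamma>)"


section \<open>Set-valued shifted tableaux\<close>

definition shifted_diagram :: "nat list \<Rightarrow> (nat \<times> nat) set" where
  "shifted_diagram lam = {(i, j). 1 \<le> i \<and> i \<le> j \<and> j < i + part lam i}"

text \<open>
  A tableau is a function from rows and columns to sets; only its values on the boxes of the
  diagram are ever used.
\<close>

definition set_valued_shifted_tableau :: "nat list \<Rightarrow> (nat \<Rightarrow> nat \<Rightarrow> nat set) \<Rightarrow> bool" where
  "set_valued_shifted_tableau lam S \<longleftrightarrow>
     (\<forall>(i, j) \<in> shifted_diagram lam. S i j \<noteq> {} \<and> S i j \<subseteq> {1..})"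

definition young_shifted_tableau :: "nat list \<Rightarrow> (nat \<Rightarrow> nat \<Rightarrow> nat set) \<Rightarrow> bool" where
  "young_shifted_tableau lam S \<longleftrightarrow>
     set_valued_shifted_tableau lam S \<and> (\<forall>(i, j) \<in> shifted_diagram lam. card (S i j) = 1)"

definition semistandard :: "nat list \<Rightarrow> (nat \<Rightarrow> nat \<Rightarrow> nat set) \<Rightarrow> bool" where
  "semistandard lam S \<longleftrightarrow>
     (\<forall>(i, j) \<in> shifted_diagram lam.
        ((i, j + 1) \<in> shifted_diagram lam \<longrightarrow> (\<forall>x \<in> S i j. \<forall>y \<in> S i (j + 1). x \<le> y)) \<and>
        ((i + 1, j) \<in> shifted_diagram lam \<longrightarrow> (\<forall>x \<in> S i j. \<forall>y \<in> S (i + 1) j. x < y)))"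

text \<open>\<open>is_entry lam S r c x\<close>: \<open>x\<close> is an entry of \<open>S\<close>, occurring in the box in row \<open>r\<close>, column \<open>c\<close>.\<close>

definition is_entry :: "nat list \<Rightarrow> (nat \<Rightarrow> nat \<Rightarrow> nat set) \<Rightarrow> nat \<Rightarrow> nat \<Rightarrow> nat \<Rightarrow> bool" where
  "is_entry lam S r c x \<longleftrightarrow> (r, c) \<in> shifted_diagram lam \<and> x \<in> S r c"

definition z_entry :: "nat \<Rightarrow> nat \<Rightarrow> nat \<Rightarrow> nat" where
  "z_entry r c x = x + c - r"

text \<open>Trailing zeros of \<open>mu\<close> are harmless: \<open>part mu x = 0\<close> contradicts \<open>z_entry r c x \<ge> x\<close>.\<close>

definition on_partition :: "nat list \<Rightarrow> nat list \<Rightarrow> (nat \<Rightarrow> nat \<Rightarrow> nat set) \<Rightarrow> bool" where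
  "on_partition mu lam S \<longleftrightarrow>
     (\<forall>r c x. is_entry lam S r c x \<longrightarrow>
        x \<le> length mu \<and> z_entry r c x \<le> part mu x + x - 1)"

end

theory Submission
  imports Defs "HOL-Analysis.Derivative"
begin

text \<open>
  The theorem reduces to one inequality about the complement \<open>\<beta>'\<close>: for every entry \<open>x\<close>, the
  numbers \<open>a = \<beta>'(x)\<close> and \<open>b = \<beta>'(z(x))\<close> satisfy \<open>a + b \<le> 2n\<close>.

  This inequality is what being on \<open>\<mu>\<close> means. Put \<open>m = \<beta>(n + 1 - x)\<close>. Unwinding \<open>\<sigma>\<close>, the bound
  \<open>z(x) \<le> \<mu>\<^sub>x + x - 1\<close> says \<open>z(x) \<le> m - (n + 1 - x)\<close>, and the right-hand side counts the elements of
  \<open>\<beta>'\<close> below \<open>m\<close>; so \<open>\<beta>'(z(x)) < m\<close>. Since barring reverses the order and exchanges \<open>\<beta>\<close> with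
  \<open>\<beta>'\<close>, it sends the \<open>x\<close>-th largest element \<open>m\<close> of \<open>\<beta>\<close> to the \<open>x\<close>-th smallest element of \<open>\<beta>'\<close>;
  so \<open>\<beta>'(x) = 2n + 1 - m\<close>. This is the content of \<open>elt_compl_sum_le\<close> and \<open>entry_compl_sum_le\<close>.

  On the Lie side, \<open>- t\<^sub>a - t\<^sub>b = t\<^bsub>bar a\<^esub> - t\<^sub>b\<close> is the weight of the matrix unit in row \<open>bar a\<close> and
  column \<open>b\<close>; this position lies strictly below the diagonal exactly when \<open>a + b \<le> 2n\<close>. With suitable
  signs, the sum of this unit and the one at the mirror position (row \<open>bar b\<close>, column \<open>a\<close>) is a matrix
  \<open>X\<close> that is skew for the symplectic form and has isotropic image, so \<open>u \<mapsto> 1 + u X\<close> is a curve in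
  \<open>B\<^sup>-\<close> with tangent \<open>X\<close>. For \<open>a = b\<close> (a long root) the two units coincide and add up. See \<open>root_vector_in_lie_borel_minus\<close> and \<open>positive_root_and_character\<close>.

  Finally, the character \<open>e\<^sup>\<theta>\<close> is a definite description, so it has to be shown that a character is
  determined by its weight (\<open>has_weight_unique\<close>). Every torus element lies on a one-parameter
  subgroup, along which a character is a differentiable homomorphism from the reals to
  \<open>\<complex>\<^sup>*\<close>, hence an exponential with rate given by the weight.
\<close>

section \<open>The torus and its Lie algebra in coordinates\<close>

definition form_sign :: "nat \<Rightarrow> nat \<Rightarrow> complex" where
  "form_sign n i = (if i < n then 1 else - 1)"

lemma form_sign_square [simp]: "form_sign n i * form_sign n i = 1"
  by (simp add: form_sign_def)

lemma form_sign_nonzero [simp]: "form_sign n i \<noteq> 0"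
  by (simp add: form_sign_def)

lemma form_sign_reflect: "i < 2 * n \<Longrightarrow> form_sign n (2 * n - 1 - i) = - form_sign n i"
  by (auto simp: form_sign_def)

lemma sp_form_sum:
  assumes "v \<in> carrier_vec (2 * n)" and "w \<in> carrier_vec (2 * n)"
  shows "sp_form n v w =
    (\<Sum>i<2 * n. form_sign n i * vec_index v i * vec_index w (2 * n - 1 - i))"
proof -
  have row: "vec_index (J_mat n *\<^sub>v w) i = form_sign n i * vec_index w (2 * n - 1 - i)"
    if i: "i < 2 * n" for i
  proof -
    have "vec_index (J_mat n *\<^sub>v w) i =
        (\<Sum>j<2 * n. (if i + j + 1 = 2 * n then form_sign n i else 0) * vec_index w j)"
      using i assms
      by (auto simp: J_mat_def scalar_prod_def form_sign_def lessThan_atLeast0 intro!: sum.cong)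
    also have "\<dots> = (\<Sum>j<2 * n. if j = 2 * n - 1 - i then form_sign n i * vec_index w j else 0)"
      using i by (intro sum.cong) auto
    also have "\<dots> = form_sign n i * vec_index w (2 * n - 1 - i)"
      using i by simp
    finally show ?thesis .
  qed
  have "sp_form n v w = (\<Sum>i<2 * n. vec_index v i * vec_index (J_mat n *\<^sub>v w) i)"
    by (simp add: sp_form_def scalar_prod_def J_mat_def lessThan_atLeast0)
  also have "\<dots> = (\<Sum>i<2 * n. form_sign n i * vec_index v i * vec_index w (2 * n - 1 - i))"
    by (intro sum.cong) (simp_all only: row lessThan_iff mult_ac)
  finally show ?thesis .
qed

lemma diagonal_mat_mult_vec_index:
  fixes s :: "complex mat"
  assumes "s \<in> carrier_mat N N" and "diagonal_mat s" and "v \<in> carrier_vec N" and "i < N"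
  shows "vec_index (s *\<^sub>v v) i = s $$ (i, i) * vec_index v i"
proof -
  have "vec_index (s *\<^sub>v v) i = (\<Sum>j<N. s $$ (i, j) * vec_index v j)"
    using assms by (simp add: scalar_prod_def lessThan_atLeast0)
  also have "\<dots> = (\<Sum>j<N. if j = i then s $$ (i, j) * vec_index v j else 0)"
    using assms by (intro sum.cong) (auto simp: diagonal_mat_def)
  also have "\<dots> = s $$ (i, i) * vec_index v i"
    using assms by simp
  finally show ?thesis .
qed

text \<open>
  For \<open>\<longrightarrow>\<close>, evaluating the preserved form on two unit vectors at mirror positions isolates one
  product of diagonal entries.
\<close>

lemma torus_iff:
  "s \<in> torus n \<longleftrightarrow> s \<in> carrier_mat (2 * n) (2 * n) \<and> diagonal_mat s \<and>
     (\<forall>i < 2 * n. s $$ (i, i) * s $$ (2 * n - 1 - i, 2 * n - 1 - i) = 1)"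
  (is "_ \<longleftrightarrow> ?R")
proof
  assume s: "s \<in> torus n"
  then have car: "s \<in> carrier_mat (2 * n) (2 * n)" and diag: "diagonal_mat s"
    and form: "\<And>v w. v \<in> carrier_vec (2 * n) \<Longrightarrow> w \<in> carrier_vec (2 * n) \<Longrightarrow>
       sp_form n (s *\<^sub>v v) (s *\<^sub>v w) = sp_form n v w"
    by (auto simp: torus_def Sp_def)
  have "s $$ (i, i) * s $$ (2 * n - 1 - i, 2 * n - 1 - i) = 1" if i: "i < 2 * n" for i
  proof -
    let ?v = "unit_vec (2 * n) i :: complex Matrix.vec"
    let ?w = "unit_vec (2 * n) (2 * n - 1 - i) :: complex Matrix.vec"
    have i': "2 * n - 1 - i < 2 * n" using i by simp
    have "sp_form n (s *\<^sub>v ?v) (s *\<^sub>v ?w) =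
        (\<Sum>j<2 * n. if j = i then form_sign n i *
           (s $$ (i, i) * s $$ (2 * n - 1 - i, 2 * n - 1 - i)) else 0)"
      using car i
      by (subst sp_form_sum; (intro sum.cong)?)
         (auto simp: diagonal_mat_mult_vec_index[OF car diag] simp del: index_mult_mat_vec)
    then have 1: "sp_form n (s *\<^sub>v ?v) (s *\<^sub>v ?w) =
        form_sign n i * (s $$ (i, i) * s $$ (2 * n - 1 - i, 2 * n - 1 - i))"
      using i by simp
    have "sp_form n ?v ?w = (\<Sum>j<2 * n. if j = i then form_sign n i else 0)"
      using i by (subst sp_form_sum; (intro sum.cong)?) auto
    then have "sp_form n ?v ?w = form_sign n i" using i by simp
    with 1 form[of ?v ?w] show ?thesis by simp
  qed
  with car diag show ?R by blast
next
  assume R: ?R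
  then have car: "s \<in> carrier_mat (2 * n) (2 * n)" and diag: "diagonal_mat s" by auto
  have "sp_form n (s *\<^sub>v v) (s *\<^sub>v w) = sp_form n v w"
    if v: "v \<in> carrier_vec (2 * n)" and w: "w \<in> carrier_vec (2 * n)" for v w
  proof -
    have "sp_form n (s *\<^sub>v v) (s *\<^sub>v w) =
      (\<Sum>i<2 * n. form_sign n i * (s $$ (i, i) * vec_index v i) *
         (s $$ (2 * n - 1 - i, 2 * n - 1 - i) * vec_index w (2 * n - 1 - i)))"
      using car v w
      by (subst sp_form_sum; (intro sum.cong)?)
         (auto simp: diagonal_mat_mult_vec_index[OF car diag] simp del: index_mult_mat_vec)
    also have "\<dots> = (\<Sum>i<2 * n. form_sign n i * vec_index v i * vec_index w (2 * n - 1 - i) *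
        (s $$ (i, i) * s $$ (2 * n - 1 - i, 2 * n - 1 - i)))"
      by (simp only: mult_ac)
    also have "\<dots> = sp_form n v w"
      using R by (subst sp_form_sum[OF v w]) (auto intro!: sum.cong)
    finally show ?thesis .
  qed
  with car diag show "s \<in> torus n"
    by (auto simp: torus_def Sp_def)
qed

lemma torus_carrier: "s \<in> torus n \<Longrightarrow> s \<in> carrier_mat (2 * n) (2 * n)"
  by (simp add: torus_iff)

lemma torus_index_inverse:
  "s \<in> torus n \<Longrightarrow> i < 2 * n \<Longrightarrow> s $$ (i, i) * s $$ (2 * n - 1 - i, 2 * n - 1 - i) = 1"
  by (simp add: torus_iff)

lemma torus_index_nonzero: "s \<in> torus n \<Longrightarrow> i < 2 * n \<Longrightarrow> s $$ (i, i) \<noteq> 0"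
  using torus_index_inverse by force

lemma mat_diag_index: "i < N \<Longrightarrow> j < N \<Longrightarrow> mat_diag N d $$ (i, j) = (if i = j then d i else 0)"
  by (simp add: mat_diag_def)

lemma diagonal_mat_eq_mat_diag:
  assumes "s \<in> carrier_mat N N" and "diagonal_mat s"
  shows "s = mat_diag N (\<lambda>i. s $$ (i, i))"
  using assms by (intro eq_matI) (auto simp: mat_diag_def diagonal_mat_def)

lemma torus_eq_mat_diag: "s \<in> torus n \<Longrightarrow> s = mat_diag (2 * n) (\<lambda>i. s $$ (i, i))"
  by (rule diagonal_mat_eq_mat_diag) (simp_all add: torus_iff)

lemma mat_diag_in_torus_iff:
  "mat_diag (2 * n) d \<in> torus n \<longleftrightarrow> (\<forall>i < 2 * n. d i * d (2 * n - 1 - i) = 1)"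
  by (auto simp: torus_iff mat_diag_def diagonal_mat_def)

lemma torus_mult_eq_mat_diag:
  assumes "s \<in> torus n" and "s' \<in> torus n"
  shows "s * s' = mat_diag (2 * n) (\<lambda>i. s $$ (i, i) * s' $$ (i, i))"
  by (subst torus_eq_mat_diag[OF assms(1)], subst torus_eq_mat_diag[OF assms(2)]) simp

lemma torus_mult_closed:
  assumes "s \<in> torus n" and "s' \<in> torus n"
  shows "s * s' \<in> torus n"
proof -
  have "(a * b) * (a' * b') = 1" if "a * a' = 1" "b * b' = 1" for a b a' b' :: complex
    using that by (metis mult.assoc mult.commute mult.right_neutral)
  then show ?thesis
    unfolding torus_mult_eq_mat_diag[OF assms] mat_diag_in_torus_iff
    using torus_index_inverse[OF assms(1)] torus_index_inverse[OF assms(2)] by blast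
qed

definition diag_exp :: "nat \<Rightarrow> (nat \<Rightarrow> complex) \<Rightarrow> real \<Rightarrow> complex mat" where
  "diag_exp n h u = mat_diag (2 * n) (\<lambda>i. exp (of_real u * h i))"

lemma diag_exp_in_torus:
  assumes "\<forall>i < 2 * n. h i + h (2 * n - 1 - i) = 0"
  shows "diag_exp n h u \<in> torus n"
  unfolding diag_exp_def mat_diag_in_torus_iff
  using assms by (auto simp: exp_add[symmetric] distrib_left[symmetric])

lemma diag_exp_add: "diag_exp n h (u + v) = diag_exp n h u * diag_exp n h v"
  by (simp add: diag_exp_def exp_add distrib_right)

lemma curve_diag_exp:
  assumes "\<forall>i < 2 * n. h i + h (2 * n - 1 - i) = 0"
  shows "curve_through_one (2 * n) (torus n) (diag_exp n h) (mat_diag (2 * n) h)"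
proof -
  have "((\<lambda>u. diag_exp n h u $$ (i, j)) has_vector_derivative mat_diag (2 * n) h $$ (i, j)) (at 0)"
    if "i < 2 * n" "j < 2 * n" for i j
  proof -
    have "((\<lambda>u. exp (u *\<^sub>R h i)) has_vector_derivative h i * exp (0 *\<^sub>R h i)) (at 0)"
      by (rule exp_scaleR_has_vector_derivative_left)
    then show ?thesis
      using that by (cases "i = j") (simp_all add: diag_exp_def mat_diag_index scaleR_conv_of_real)
  qed
  moreover have "diag_exp n h 0 = 1\<^sub>m (2 * n)"
    by (simp add: diag_exp_def)
  ultimately show ?thesis
    using diag_exp_in_torus[OF assms] by (auto simp: curve_through_one_def)
qed

text \<open>
  Necessity differentiates the equations of the torus; sufficiency uses the exponential
  curve. The description shows that the Lie algebra of the torus is a complex vector space, which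
  its definition by real curves leaves open.
\<close>

lemma lie_torus_iff:
  "H \<in> lie_torus n \<longleftrightarrow> H \<in> carrier_mat (2 * n) (2 * n) \<and> diagonal_mat H \<and>
     (\<forall>i < 2 * n. H $$ (i, i) + H $$ (2 * n - 1 - i, 2 * n - 1 - i) = 0)"
  (is "_ \<longleftrightarrow> ?R")
proof
  assume "H \<in> lie_torus n"
  then obtain \<gamma> where car: "H \<in> carrier_mat (2 * n) (2 * n)" and t: "\<And>u. \<gamma> u \<in> torus n"
    and one: "\<gamma> 0 = 1\<^sub>m (2 * n)"
    and der: "\<And>i j. i < 2 * n \<Longrightarrow> j < 2 * n \<Longrightarrow>
      ((\<lambda>u. \<gamma> u $$ (i, j)) has_vector_derivative H $$ (i, j)) (at 0)"
    by (auto simp: lie_algebra_def curve_through_one_def)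
  have "H $$ (i, j) = 0" if ij: "i < 2 * n" "j < 2 * n" "i \<noteq> j" for i j
  proof -
    have "\<gamma> u $$ (i, j) = 0" for u
      using t[of u] ij unfolding torus_iff diagonal_mat_def by auto
    then have "((\<lambda>u. \<gamma> u $$ (i, j)) has_vector_derivative 0) (at 0)" by simp
    with der[OF ij(1,2)] show ?thesis by (rule vector_derivative_unique_at)
  qed
  then have diag: "diagonal_mat H" using car by (auto simp: diagonal_mat_def)
  have "H $$ (i, i) + H $$ (2 * n - 1 - i, 2 * n - 1 - i) = 0" if i: "i < 2 * n" for i
  proof -
    let ?j = "2 * n - 1 - i"
    have j: "?j < 2 * n" using i by simp
    have "((\<lambda>u. \<gamma> u $$ (i, i) * \<gamma> u $$ (?j, ?j)) has_vector_derivative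
        \<gamma> 0 $$ (i, i) * H $$ (?j, ?j) + H $$ (i, i) * \<gamma> 0 $$ (?j, ?j)) (at 0)"
      by (rule has_vector_derivative_mult[OF der[OF i i] der[OF j j]])
    moreover have "\<gamma> u $$ (i, i) * \<gamma> u $$ (?j, ?j) = 1" for u
      by (rule torus_index_inverse[OF t i])
    ultimately have "((\<lambda>u. 1) has_vector_derivative
        \<gamma> 0 $$ (i, i) * H $$ (?j, ?j) + H $$ (i, i) * \<gamma> 0 $$ (?j, ?j)) (at 0)"
      by (simp only:)
    then have "\<gamma> 0 $$ (i, i) * H $$ (?j, ?j) + H $$ (i, i) * \<gamma> 0 $$ (?j, ?j) = 0"
      by (rule vector_derivative_unique_at) simp
    then show ?thesis
      using one i j by (simp add: add.commute)
  qed
  with car diag show ?R by blast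
next
  assume R: ?R
  then have "H = mat_diag (2 * n) (\<lambda>i. H $$ (i, i))"
    by (intro diagonal_mat_eq_mat_diag) auto
  with curve_diag_exp[of n "\<lambda>i. H $$ (i, i)"] R show "H \<in> lie_torus n"
    by (auto simp: lie_algebra_def)
qed

section \<open>Characters are determined by their weights\<close>

text \<open>
  Dividing \<open>f\<close> by the expected exponential leaves a homomorphism \<open>g\<close> whose derivative vanishes at 0,
  hence everywhere by translation; so \<open>g\<close> is constant.
\<close>

lemma real_homomorphism_eq_exp:
  fixes f :: "real \<Rightarrow> complex"
  assumes hom: "\<And>u v. f (u + v) = f u * f v" and nz: "f 0 \<noteq> 0"
    and der: "(f has_vector_derivative c) (at 0)"
  shows "f u = exp (of_real u * c)"
proof -
  define g where "g u = f u * exp (- (of_real u * c))" for u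
  have f0: "f 0 = 1" using hom[of 0 0] nz by simp
  have g_hom: "g (u + v) = g u * g v" for u v
    by (simp add: g_def hom exp_add[symmetric] algebra_simps)
  have "((\<lambda>u. exp (u *\<^sub>R (- c))) has_vector_derivative - c * exp (0 *\<^sub>R (- c))) (at 0)"
    by (rule exp_scaleR_has_vector_derivative_left)
  then have "((\<lambda>u. exp (- (of_real u * c))) has_vector_derivative - c) (at 0)"
    by (simp add: scaleR_conv_of_real)
  from has_vector_derivative_mult[OF der this] have g_der0: "(g has_vector_derivative 0) (at 0)"
    by (simp add: g_def[abs_def] f0)
  have g_der: "(g has_vector_derivative 0) (at v)" for v
  proof -
    have "((\<lambda>x. x - v) has_vector_derivative 1) (at v)"
      by (auto intro!: derivative_eq_intros)
    moreover have "(g has_vector_derivative 0) (at (v - v))" using g_der0 by simp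
    ultimately have "(g \<circ> (\<lambda>x. x - v) has_vector_derivative 1 *\<^sub>R 0) (at v)"
      by (rule vector_diff_chain_at)
    from has_vector_derivative_mult_right[OF this, of "g v"]
    have "((\<lambda>x. g v * g (x - v)) has_vector_derivative 0) (at v)" by (simp add: o_def)
    then show ?thesis using g_hom[of v, symmetric] by simp
  qed
  have "\<exists>k. \<forall>x \<in> UNIV. g x = k"
    using g_der has_vector_derivative_zero_constant[of UNIV g]
    by (metis UNIV_I convex_UNIV)
  then have "g u = g 0" by auto
  then have "f u * exp (- (of_real u * c)) = 1" by (simp add: g_def f0)
  then show ?thesis by (simp add: exp_minus field_simps)
qed

lemma complex_exp_surj:
  assumes "z \<noteq> 0"
  obtains w :: complex where "exp w = z"
proof
  have "exp (of_real (ln (cmod z)) + \<i> * of_real (Arg z)) = rcis (cmod z) (Arg z)"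
    using assms by (simp add: exp_add exp_of_real rcis_def cis_conv_exp)
  then show "exp (of_real (ln (cmod z)) + \<i> * of_real (Arg z)) = z"
    by (simp add: rcis_cmod_Arg)
qed

text \<open>
  The logarithms are chosen on the first half of the diagonal only; the second half is forced by
  symmetry, so that the exponents satisfy the equations of the Lie algebra exactly and not just
  modulo \<open>2 \<pi> \<i>\<close>.
\<close>

lemma torus_eq_diag_exp:
  assumes s: "s \<in> torus n"
  obtains h where "\<forall>i < 2 * n. h i + h (2 * n - 1 - i) = 0" and "s = diag_exp n h 1"
proof -
  have "\<forall>i. \<exists>w. i < 2 * n \<longrightarrow> exp w = s $$ (i, i)"
    using torus_index_nonzero[OF s] complex_exp_surj by metis
  then obtain l where l: "\<And>i. i < 2 * n \<Longrightarrow> exp (l i) = s $$ (i, i)" by metis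
  define h where "h i = (if i < n then l i else - l (2 * n - 1 - i))" for i
  have h: "exp (h i) = s $$ (i, i)" if i: "i < 2 * n" for i
  proof (cases "i < n")
    case True
    then show ?thesis using l[OF i] by (simp add: h_def)
  next
    case False
    have "2 * n - 1 - i < 2 * n" using i by simp
    then show ?thesis
      using False l torus_index_inverse[OF s i] torus_index_nonzero[OF s]
      by (simp add: h_def exp_minus field_simps)
  qed
  show ?thesis
  proof
    show "\<forall>i < 2 * n. h i + h (2 * n - 1 - i) = 0"
      by (auto simp: h_def)
    show "s = diag_exp n h 1"
      by (subst torus_eq_mat_diag[OF s]) (auto simp: diag_exp_def mat_diag_def h intro!: eq_matI)
  qed
qed

lemma has_weight_unique:
  assumes "has_weight n \<phi> \<theta>" and "has_weight n \<phi>' \<theta>"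
  shows "\<phi> = \<phi>'"
proof (rule ext)
  fix s
  show "\<phi> s = \<phi>' s"
  proof (cases "s \<in> torus n")
    case True
    then obtain h where h: "\<forall>i < 2 * n. h i + h (2 * n - 1 - i) = 0" and s: "s = diag_exp n h 1"
      by (rule torus_eq_diag_exp)
    have "\<psi> s = exp (\<theta> (mat_diag (2 * n) h))" if \<psi>: "has_weight n \<psi> \<theta>" for \<psi>
    proof -
      have "\<psi> (diag_exp n h 1) = exp (of_real 1 * \<theta> (mat_diag (2 * n) h))"
      proof (rule real_homomorphism_eq_exp)
        show "\<psi> (diag_exp n h (u + v)) = \<psi> (diag_exp n h u) * \<psi> (diag_exp n h v)" for u v
          using \<psi> diag_exp_in_torus[OF h]
          by (simp add: has_weight_def torus_characters_def diag_exp_add)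
        show "\<psi> (diag_exp n h 0) \<noteq> 0"
          using \<psi> diag_exp_in_torus[OF h] by (simp add: has_weight_def torus_characters_def)
        show "((\<lambda>u. \<psi> (diag_exp n h u)) has_vector_derivative \<theta> (mat_diag (2 * n) h)) (at 0)"
          using \<psi> curve_diag_exp[OF h] by (simp add: has_weight_def)
      qed
      then show ?thesis by (simp add: s)
    qed
    then show ?thesis using assms by metis
  next
    case False
    then show ?thesis
      using assms by (auto simp: has_weight_def torus_characters_def rep_ring_def)
  qed
qed

lemma exp_weight_eq: "has_weight n \<phi> \<theta> \<Longrightarrow> exp_weight n \<theta> = \<phi>"
  unfolding exp_weight_def by (rule the_equality) (auto intro: has_weight_unique)

section \<open>The representation ring\<close>

lemma rep_ring_diff:
  assumes "f \<in> rep_ring n" and "g \<in> rep_ring n"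
  shows "(\<lambda>s\<in>torus n. f s - g s) \<in> rep_ring n"
proof -
  let ?M = "\<lambda>(m :: nat \<Rightarrow> int) s. \<Prod>k = 1..n. t_char n k s powi m k"
  obtain E c where E: "finite E" and f: "f = (\<lambda>s\<in>torus n. \<Sum>m\<in>E. c m * ?M m s)"
    using assms(1) by (auto simp: rep_ring_def)
  obtain F d where F: "finite F" and g: "g = (\<lambda>s\<in>torus n. \<Sum>m\<in>F. d m * ?M m s)"
    using assms(2) by (auto simp: rep_ring_def)
  define e where "e m = (if m \<in> E then c m else 0) - (if m \<in> F then d m else 0)" for m
  have "(\<Sum>m\<in>E. c m * ?M m s) - (\<Sum>m\<in>F. d m * ?M m s) = (\<Sum>m\<in>E \<union> F. e m * ?M m s)" for s
  proof -
    have "(\<Sum>m\<in>E. c m * ?M m s) = (\<Sum>m\<in>E \<union> F. (if m \<in> E then c m else 0) * ?M m s)"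
      using E F by (intro sum.mono_neutral_cong_left) auto
    moreover have "(\<Sum>m\<in>F. d m * ?M m s) = (\<Sum>m\<in>E \<union> F. (if m \<in> F then d m else 0) * ?M m s)"
      using E F by (intro sum.mono_neutral_cong_left) auto
    ultimately show ?thesis
      by (simp add: e_def left_diff_distrib sum_subtractf)
  qed
  then have "(\<lambda>s\<in>torus n. f s - g s) = (\<lambda>s\<in>torus n. \<Sum>m\<in>E \<union> F. e m * ?M m s)"
    by (auto simp: f g intro!: restrict_ext)
  with E F show ?thesis
    unfolding rep_ring_def by blast
qed

lemma monomial_in_rep_ring:
  fixes m :: "nat \<Rightarrow> int"
  shows "(\<lambda>s\<in>torus n. \<Prod>k = 1..n. t_char n k s powi m k) \<in> rep_ring n"
  unfolding rep_ring_def
  by (intro CollectI exI[of _ "{m}"] exI[of _ "\<lambda>_. 1"]) simp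

lemma one_in_rep_ring: "(\<lambda>s\<in>torus n. 1) \<in> rep_ring n"
  using monomial_in_rep_ring[of n "\<lambda>_. 0"] by simp

lemma t_char_eq_index:
  assumes "s \<in> torus n" and "1 \<le> k" and "k \<le> 2 * n"
  shows "t_char n k s = s $$ (k - 1, k - 1)"
proof (cases "k \<le> n")
  case True
  then show ?thesis using assms by (simp add: t_char_def)
next
  case False
  have "s $$ (k - 1, k - 1) * s $$ (2 * n - 1 - (k - 1), 2 * n - 1 - (k - 1)) = 1"
    using assms by (intro torus_index_inverse) auto
  moreover have "2 * n - 1 - (k - 1) = bar n k - 1" using assms by (simp add: bar_def)
  ultimately have "s $$ (k - 1, k - 1) * s $$ (bar n k - 1, bar n k - 1) = 1" by simp
  then have "s $$ (k - 1, k - 1) = inverse (s $$ (bar n k - 1, bar n k - 1))"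
    by (metis inverse_unique mult.commute)
  then show ?thesis using assms False by (simp add: t_char_def)
qed

lemma t_weight_eq_index:
  assumes "H \<in> lie_torus n" and "1 \<le> k" and "k \<le> 2 * n"
  shows "t_weight n k H = H $$ (k - 1, k - 1)"
proof (cases "k \<le> n")
  case True
  then show ?thesis using assms by (simp add: t_weight_def)
next
  case False
  have "H $$ (k - 1, k - 1) + H $$ (2 * n - 1 - (k - 1), 2 * n - 1 - (k - 1)) = 0"
    using assms(2,3) by (intro assms(1)[unfolded lie_torus_iff, THEN conjunct2, THEN conjunct2, rule_format]) simp
  moreover have "2 * n - 1 - (k - 1) = bar n k - 1" using assms by (simp add: bar_def)
  ultimately have "H $$ (k - 1, k - 1) + H $$ (bar n k - 1, bar n k - 1) = 0" by simp
  then have "H $$ (k - 1, k - 1) = - H $$ (bar n k - 1, bar n k - 1)"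
    by (simp add: eq_neg_iff_add_eq_0)
  then show ?thesis using assms False by (simp add: t_weight_def)
qed

text \<open>
  The exponent vector of \<open>t\<^sub>j\<close> as a Laurent monomial in \<open>t\<^sub>1, \<dots>, t\<^sub>n\<close>; for \<open>j > n\<close> it comes from
  \<open>t\<^sub>j = t\<^bsub>bar j\<^esub>\<^sup>-\<^sup>1\<close>.
\<close>

definition t_exponent :: "nat \<Rightarrow> nat \<Rightarrow> nat \<Rightarrow> int" where
  "t_exponent n j k = (if k = j then 1 else if k = bar n j then - 1 else 0)"

lemma t_char_eq_monomial:
  assumes s: "s \<in> torus n" and j: "1 \<le> j" "j \<le> 2 * n"
  shows "(\<Prod>k = 1..n. t_char n k s powi t_exponent n j k) = t_char n j s"
proof -
  define j' where "j' = (if j \<le> n then j else bar n j)"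
  have j': "j' \<in> {1..n}" using j by (auto simp: j'_def bar_def)
  have "(\<Prod>k = 1..n. t_char n k s powi t_exponent n j k) =
      (\<Prod>k = 1..n. if k = j' then t_char n j s else 1)"
    using s j by (intro prod.cong)
      (auto simp: j'_def t_exponent_def bar_def t_char_def power_int_minus)
  also have "\<dots> = t_char n j s"
    using j' by simp
  finally show ?thesis .
qed

lemma inverse_t_char_product_in_rep_ring:
  assumes "1 \<le> a" "a \<le> 2 * n" "1 \<le> b" "b \<le> 2 * n"
  shows "(\<lambda>s\<in>torus n. 1 / (t_char n a s * t_char n b s)) \<in> rep_ring n"
proof -
  have nz: "t_char n k s \<noteq> 0" if "s \<in> torus n" "k \<in> {1..n}" for s k
  proof -
    have "k - 1 < 2 * n" using that(2) by auto
    then show ?thesis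
      using that torus_index_nonzero[of s n "k - 1"] by (subst t_char_eq_index) auto
  qed
  have "(\<Prod>k = 1..n. t_char n k s powi (- t_exponent n a k - t_exponent n b k)) =
      1 / (t_char n a s * t_char n b s)" if s: "s \<in> torus n" for s
  proof -
    have "(\<Prod>k = 1..n. t_char n k s powi (- t_exponent n a k - t_exponent n b k)) =
      (\<Prod>k = 1..n. inverse (t_char n k s powi t_exponent n a k) *
         inverse (t_char n k s powi t_exponent n b k))"
      using nz[OF s] by (intro prod.cong)
        (auto simp: power_int_diff power_int_minus divide_inverse)
    also have "\<dots> = inverse (t_char n a s) * inverse (t_char n b s)"
      by (simp only: prod.distrib prod_inversef[unfolded o_def]
          t_char_eq_monomial[OF s assms(1,2)] t_char_eq_monomial[OF s assms(3,4)])
    finally show ?thesis by (simp add: field_simps)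
  qed
  then have "(\<lambda>s\<in>torus n. 1 / (t_char n a s * t_char n b s)) =
      (\<lambda>s\<in>torus n. \<Prod>k = 1..n. t_char n k s powi (- t_exponent n a k - t_exponent n b k))"
    by (auto intro!: restrict_ext)
  then show ?thesis
    using monomial_in_rep_ring[of n "\<lambda>k. - t_exponent n a k - t_exponent n b k"] by (simp only:)
qed

section \<open>Root vectors\<close>

text \<open>
  This is \<open>J\<^sup>-\<^sup>1\<close> times the symmetric matrix \<open>E\<^sub>p\<^sub>q + E\<^sub>q\<^sub>p\<close>, with indices from 0: the symplectic Lie algebra consists of the \<open>X\<close> with \<open>J X\<close>
  symmetric. For \<open>p = q\<close> the two summands add up to twice a matrix unit.
\<close>

definition root_vector :: "nat \<Rightarrow> nat \<Rightarrow> nat \<Rightarrow> complex mat" where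
  "root_vector n p q = Matrix.mat (2 * n) (2 * n) (\<lambda>(i, j).
     (if i = 2 * n - 1 - p \<and> j = q then form_sign n p else 0) +
     (if i = 2 * n - 1 - q \<and> j = p then form_sign n q else 0))"

lemma root_vector_carrier [simp]: "root_vector n p q \<in> carrier_mat (2 * n) (2 * n)"
  by (simp add: root_vector_def)

lemma root_vector_index:
  assumes "i < 2 * n" and "j < 2 * n"
  shows "root_vector n p q $$ (i, j) =
    (if i = 2 * n - 1 - p \<and> j = q then form_sign n p else 0) +
    (if i = 2 * n - 1 - q \<and> j = p then form_sign n q else 0)"
  using assms by (simp add: root_vector_def)

lemma root_vector_mult_vec_index:
  assumes "v \<in> carrier_vec (2 * n)" and "p < 2 * n" and "q < 2 * n" and "i < 2 * n"
  shows "vec_index (root_vector n p q *\<^sub>v v) i =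
    (if i = 2 * n - 1 - p then form_sign n p * vec_index v q else 0) +
    (if i = 2 * n - 1 - q then form_sign n q * vec_index v p else 0)"
proof -
  have "vec_index (root_vector n p q *\<^sub>v v) i =
    (\<Sum>j<2 * n. root_vector n p q $$ (i, j) * vec_index v j)"
    using assms by (simp add: scalar_prod_def lessThan_atLeast0 root_vector_def)
  also have "\<dots> = (\<Sum>j<2 * n.
      (if j = q then if i = 2 * n - 1 - p then form_sign n p * vec_index v q else 0 else 0) +
      (if j = p then if i = 2 * n - 1 - q then form_sign n q * vec_index v p else 0 else 0))"
    using assms by (intro sum.cong) (auto simp: root_vector_def algebra_simps)
  also have "\<dots> = (if i = 2 * n - 1 - p then form_sign n p * vec_index v q else 0) +
    (if i = 2 * n - 1 - q then form_sign n q * vec_index v p else 0)"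
    using assms unfolding sum.distrib by simp
  finally show ?thesis .
qed

lemma root_vector_skew:
  assumes v: "v \<in> carrier_vec (2 * n)" and w: "w \<in> carrier_vec (2 * n)"
    and p: "p < 2 * n" and q: "q < 2 * n"
  defines "X \<equiv> root_vector n p q"
  shows "sp_form n (X *\<^sub>v v) w = - (vec_index v q * vec_index w p + vec_index v p * vec_index w q)"
    and "sp_form n v (X *\<^sub>v w) = vec_index v q * vec_index w p + vec_index v p * vec_index w q"
proof -
  have Xv: "X *\<^sub>v v \<in> carrier_vec (2 * n)" and Xw: "X *\<^sub>v w \<in> carrier_vec (2 * n)"
    by (simp_all add: X_def root_vector_def carrier_vecI)
  have "sp_form n (X *\<^sub>v v) w = (\<Sum>i<2 * n.
      (if i = 2 * n - 1 - p then - (vec_index v q * vec_index w p) else 0) +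
      (if i = 2 * n - 1 - q then - (vec_index v p * vec_index w q) else 0))"
    unfolding X_def sp_form_sum[OF Xv[unfolded X_def] w]
  proof (intro sum.cong refl)
    fix i assume "i \<in> {..<2 * n}"
    then have i: "i < 2 * n" by simp
    show "form_sign n i * vec_index (root_vector n p q *\<^sub>v v) i * vec_index w (2 * n - 1 - i) =
      (if i = 2 * n - 1 - p then - (vec_index v q * vec_index w p) else 0) +
      (if i = 2 * n - 1 - q then - (vec_index v p * vec_index w q) else 0)"
      unfolding root_vector_mult_vec_index[OF v p q i] distrib_left distrib_right
    proof (intro arg_cong2[where f = "(+)"])
      have "2 * n - 1 - (2 * n - 1 - k) = k" if "k < 2 * n" for k using that by simp
      then show "form_sign n i * (if i = 2 * n - 1 - p then form_sign n p * vec_index v q else 0) *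
          vec_index w (2 * n - 1 - i) =
          (if i = 2 * n - 1 - p then - (vec_index v q * vec_index w p) else 0)"
        and "form_sign n i * (if i = 2 * n - 1 - q then form_sign n q * vec_index v p else 0) *
          vec_index w (2 * n - 1 - i) =
          (if i = 2 * n - 1 - q then - (vec_index v p * vec_index w q) else 0)"
        using form_sign_reflect[OF p] form_sign_reflect[OF q] p q
        by (simp_all add: mult.assoc[symmetric])
    qed
  qed
  then show "sp_form n (X *\<^sub>v v) w =
      - (vec_index v q * vec_index w p + vec_index v p * vec_index w q)"
    using p q by (simp add: sum.distrib)
  have "sp_form n v (X *\<^sub>v w) = (\<Sum>i<2 * n.
      (if i = p then vec_index v p * vec_index w q else 0) +
      (if i = q then vec_index v q * vec_index w p else 0))"
    unfolding X_def sp_form_sum[OF v Xw[unfolded X_def]]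
  proof (intro sum.cong refl)
    fix i assume "i \<in> {..<2 * n}"
    then have i: "i < 2 * n" and ri: "2 * n - 1 - i < 2 * n" by auto
    have eqs: "2 * n - 1 - i = 2 * n - 1 - p \<longleftrightarrow> i = p" "2 * n - 1 - i = 2 * n - 1 - q \<longleftrightarrow> i = q"
      using i p q by auto
    show "form_sign n i * vec_index v i * vec_index (root_vector n p q *\<^sub>v w) (2 * n - 1 - i) =
      (if i = p then vec_index v p * vec_index w q else 0) +
      (if i = q then vec_index v q * vec_index w p else 0)"
      unfolding root_vector_mult_vec_index[OF w p q ri] eqs
      by (auto simp: form_sign_def algebra_simps)
  qed
  then show "sp_form n v (X *\<^sub>v w) = vec_index v q * vec_index w p + vec_index v p * vec_index w q"
    using p q by (simp add: sum.distrib add.commute)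
qed

text \<open>
  By skewness it suffices that \<open>X w\<close> vanishes at the positions \<open>p\<close> and \<open>q\<close>. It does, because it is
  supported at their mirror positions. A position is never its own mirror, by parity, and \<open>p\<close> is not the mirror
  of \<open>q\<close> because \<open>p + q + 1 < 2n\<close>.
\<close>

lemma root_vector_isotropic:
  assumes v: "v \<in> carrier_vec (2 * n)" and w: "w \<in> carrier_vec (2 * n)"
    and p: "p < 2 * n" and q: "q < 2 * n" and pq: "p + q + 1 < 2 * n"
  defines "X \<equiv> root_vector n p q"
  shows "sp_form n (X *\<^sub>v v) (X *\<^sub>v w) = 0"
proof -
  have Xw: "X *\<^sub>v w \<in> carrier_vec (2 * n)"
    by (simp add: X_def root_vector_def carrier_vecI)
  have "p \<noteq> 2 * n - 1 - p" "q \<noteq> 2 * n - 1 - q" using p q by presburger+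
  then have "vec_index (X *\<^sub>v w) p = 0" and "vec_index (X *\<^sub>v w) q = 0"
    unfolding X_def root_vector_mult_vec_index[OF w p q p] root_vector_mult_vec_index[OF w p q q]
    using pq by auto
  then show ?thesis
    unfolding X_def root_vector_skew(1)[OF v Xw[unfolded X_def] p q] by simp
qed

lemma sp_form_add_smult:
  assumes "v \<in> carrier_vec (2 * n)" "v' \<in> carrier_vec (2 * n)"
    "w \<in> carrier_vec (2 * n)" "w' \<in> carrier_vec (2 * n)"
  shows "sp_form n (v + c \<cdot>\<^sub>v v') (w + c \<cdot>\<^sub>v w') = sp_form n v w +
    c * (sp_form n v' w + sp_form n v w') + c * c * sp_form n v' w'"
proof -
  have "sp_form n (v + c \<cdot>\<^sub>v v') (w + c \<cdot>\<^sub>v w') =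
    (\<Sum>i<2 * n. form_sign n i * (vec_index v i + c * vec_index v' i) *
       (vec_index w (2 * n - 1 - i) + c * vec_index w' (2 * n - 1 - i)))"
    using assms by (subst sp_form_sum; (intro sum.cong)?) auto
  also have "\<dots> = sp_form n v w +
    c * (sp_form n v' w + sp_form n v w') + c * c * sp_form n v' w'"
    using assms by (simp add: sp_form_sum sum.distrib[symmetric] sum_distrib_left algebra_simps)
  finally show ?thesis .
qed

text \<open>
  The form evaluated along the curve \<open>1 + u X\<close> is quadratic in \<open>u\<close>: its linear coefficient vanishes by
  skewness and its quadratic one by isotropy. The matrix is lower triangular because
  \<open>p + q + 1 < 2n\<close> puts both units below the diagonal.
\<close>

lemma root_vector_in_lie_borel_minus:
  assumes p: "p < 2 * n" and q: "q < 2 * n" and pq: "p + q + 1 < 2 * n"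
  shows "root_vector n p q \<in> lie_borel_minus n"
proof -
  let ?X = "root_vector n p q"
  define g where "g u = 1\<^sub>m (2 * n) + of_real u \<cdot>\<^sub>m ?X" for u :: real
  have gv: "g u *\<^sub>v v = v + of_real u \<cdot>\<^sub>v (?X *\<^sub>v v)" if v: "v \<in> carrier_vec (2 * n)" for u v
  proof -
    have "g u *\<^sub>v v = 1\<^sub>m (2 * n) *\<^sub>v v + (of_real u \<cdot>\<^sub>m ?X) *\<^sub>v v"
      unfolding g_def by (rule add_mult_distrib_mat_vec) (use v in auto)
    also have "(of_real u \<cdot>\<^sub>m ?X) *\<^sub>v v = of_real u \<cdot>\<^sub>v (?X *\<^sub>v v)"
      using v by (intro eq_vecI) (auto simp: root_vector_def)
    finally show ?thesis using v by simp
  qed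
  have car: "g u \<in> carrier_mat (2 * n) (2 * n)" for u
    by (simp add: g_def)
  have "sp_form n (g u *\<^sub>v v) (g u *\<^sub>v w) = sp_form n v w"
    if v: "v \<in> carrier_vec (2 * n)" and w: "w \<in> carrier_vec (2 * n)" for u v w
  proof -
    have "?X *\<^sub>v v \<in> carrier_vec (2 * n)" "?X *\<^sub>v w \<in> carrier_vec (2 * n)"
      by (simp_all add: root_vector_def carrier_vecI)
    then show ?thesis
      using v w
      by (simp add: gv sp_form_add_smult root_vector_skew[OF v w p q]
          root_vector_isotropic[OF v w p q pq])
  qed
  moreover have "g u $$ (i, j) = 0" if "i < j" "i < 2 * n" "j < 2 * n" for u i j
  proof -
    have "\<not> (i = 2 * n - 1 - p \<and> j = q)" "\<not> (i = 2 * n - 1 - q \<and> j = p)"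
      using that pq by linarith+
    then have "?X $$ (i, j) = 0"
      unfolding root_vector_index[OF that(2,3)] by (simp only: if_False add_0)
    then show ?thesis using that by (simp add: g_def root_vector_def)
  qed
  ultimately have "g u \<in> borel_minus n" for u
    using car by (auto simp: borel_minus_def Sp_def)
  moreover have "((\<lambda>u. g u $$ (i, j)) has_vector_derivative ?X $$ (i, j)) (at 0)"
    if ij: "i < 2 * n" "j < 2 * n" for i j
  proof -
    have "g u $$ (i, j) = 1\<^sub>m (2 * n) $$ (i, j) + u *\<^sub>R ?X $$ (i, j)" for u
      using ij by (simp add: g_def root_vector_def scaleR_conv_of_real)
    then show ?thesis
      by (auto intro!: derivative_eq_intros)
  qed
  moreover have "g 0 = 1\<^sub>m (2 * n)"
    by (intro eq_matI) (auto simp: g_def root_vector_def)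
  ultimately show ?thesis
    unfolding lie_algebra_def curve_through_one_def by (intro CollectI exI[of _ g]) simp
qed

lemma root_vector_nonzero:
  assumes p: "p < 2 * n" and q: "q < 2 * n"
  shows "root_vector n p q \<noteq> 0\<^sub>m (2 * n) (2 * n)"
proof
  assume "root_vector n p q = 0\<^sub>m (2 * n) (2 * n)"
  then have "root_vector n p q $$ (2 * n - 1 - p, q) = 0" using p q by simp
  then show False using p q by (auto simp: root_vector_def split: if_splits)
qed

lemma torus_inverse:
  assumes s: "s \<in> torus n"
  shows "s * the (mat_inverse s) = 1\<^sub>m (2 * n)"
    and "the (mat_inverse s) \<in> carrier_mat (2 * n) (2 * n)"
proof -
  let ?d = "\<lambda>i. s $$ (i, i)"
  let ?t = "mat_diag (2 * n) (\<lambda>i. inverse (?d i))"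
  have car: "s \<in> carrier_mat (2 * n) (2 * n)" by (rule torus_carrier[OF s])
  have "s * ?t = mat_diag (2 * n) (\<lambda>i. ?d i * inverse (?d i))"
    by (subst torus_eq_mat_diag[OF s]) simp
  also have "\<dots> = 1\<^sub>m (2 * n)"
    using torus_index_nonzero[OF s] by (intro eq_matI) (auto simp: mat_diag_def)
  finally have 1: "s * ?t = 1\<^sub>m (2 * n)" .
  have "?t * s = mat_diag (2 * n) (\<lambda>i. inverse (?d i) * ?d i)"
    by (subst (2) torus_eq_mat_diag[OF s]) simp
  also have "\<dots> = 1\<^sub>m (2 * n)"
    using torus_index_nonzero[OF s] by (intro eq_matI) (auto simp: mat_diag_def)
  finally have "?t * s = 1\<^sub>m (2 * n)" .
  with 1 car have "s \<in> Units (ring_mat TYPE(complex) (2 * n) ())"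
    by (auto simp: Units_def ring_mat_def intro!: bexI[of _ ?t])
  then obtain B where "mat_inverse s = Some B"
    using mat_inverse(1)[OF car, where b = "()"] by (cases "mat_inverse s") auto
  with mat_inverse(2)[OF car this]
  show "s * the (mat_inverse s) = 1\<^sub>m (2 * n)"
    and "the (mat_inverse s) \<in> carrier_mat (2 * n) (2 * n)" by auto
qed

text \<open>
  Multiplying \<open>s X = c X s\<close> by the inverse from the right avoids computing the inverse.
\<close>

lemma adjoint_action_eqI:
  assumes s: "s \<in> torus n" and X: "X \<in> carrier_mat (2 * n) (2 * n)"
    and eig: "\<And>i j. i < 2 * n \<Longrightarrow> j < 2 * n \<Longrightarrow>
      s $$ (i, i) * X $$ (i, j) = c * X $$ (i, j) * s $$ (j, j)"
  shows "adjoint_action s X = c \<cdot>\<^sub>m X"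
proof -
  let ?B = "the (mat_inverse s)"
  note car = torus_carrier[OF s]
  have "s * X = c \<cdot>\<^sub>m X * s"
    by (subst (1 2) torus_eq_mat_diag[OF s],
        subst mat_diag_mult_left[OF X], subst mat_diag_mult_right[where nr = "2 * n"])
      (use X eig in \<open>auto intro!: eq_matI\<close>)
  then have "s * X * ?B = c \<cdot>\<^sub>m X * s * ?B" by simp
  also have "\<dots> = c \<cdot>\<^sub>m X * (s * ?B)"
    by (rule assoc_mult_mat) (use X car torus_inverse(2)[OF s] in auto)
  also have "\<dots> = c \<cdot>\<^sub>m X"
    using X by (simp add: torus_inverse(1)[OF s])
  finally show ?thesis by (simp add: adjoint_action_def)
qed

lemma adjoint_action_root_vector:
  assumes s: "s \<in> torus n" and p: "p < 2 * n" and q: "q < 2 * n"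
  shows "adjoint_action s (root_vector n p q) =
    (s $$ (2 * n - 1 - p, 2 * n - 1 - p) * s $$ (2 * n - 1 - q, 2 * n - 1 - q)) \<cdot>\<^sub>m root_vector n p q"
proof (rule adjoint_action_eqI[OF s])
  fix i j assume "i < 2 * n" "j < 2 * n"
  then have ij: "i < 2 * n" "j < 2 * n" .
  let ?A = "s $$ (2 * n - 1 - p, 2 * n - 1 - p)"
  let ?B = "s $$ (2 * n - 1 - q, 2 * n - 1 - q)"
  define e where "e = (if i = 2 * n - 1 - p \<and> j = q then form_sign n p else 0)"
  define e' where "e' = (if i = 2 * n - 1 - q \<and> j = p then form_sign n q else 0)"
  have "s $$ (i, i) * e = ?A * ?B * e * s $$ (j, j)"
  proof (cases "i = 2 * n - 1 - p \<and> j = q")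
    case True
    have "?A * e = ?A * e * (s $$ (q, q) * ?B)"
      by (simp only: torus_index_inverse[OF s q] mult_1_right)
    with True show ?thesis by (simp only: mult_ac)
  qed (simp only: e_def if_False mult_zero_left mult_zero_right)
  moreover have "s $$ (i, i) * e' = ?A * ?B * e' * s $$ (j, j)"
  proof (cases "i = 2 * n - 1 - q \<and> j = p")
    case True
    have "?B * e' = ?B * e' * (s $$ (p, p) * ?A)"
      by (simp only: torus_index_inverse[OF s p] mult_1_right)
    with True show ?thesis by (simp only: mult_ac)
  qed (simp only: e'_def if_False mult_zero_left mult_zero_right)
  moreover have "root_vector n p q $$ (i, j) = e + e'"
    unfolding e_def e'_def by (rule root_vector_index[OF ij])
  ultimately show "s $$ (i, i) * root_vector n p q $$ (i, j) =
      ?A * ?B * root_vector n p q $$ (i, j) * s $$ (j, j)"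
    by (simp only: distrib_left distrib_right)
qed simp

lemma lie_torus_add_closed:
  assumes H: "H \<in> lie_torus n" and H': "H' \<in> lie_torus n"
  shows "H + H' \<in> lie_torus n"
proof -
  have index: "(H + H') $$ (i, j) = H $$ (i, j) + H' $$ (i, j)" if "i < 2 * n" "j < 2 * n" for i j
    using H' that by (auto simp: lie_torus_iff)
  have "H $$ (i, i) + H' $$ (i, i) +
      (H $$ (2 * n - 1 - i, 2 * n - 1 - i) + H' $$ (2 * n - 1 - i, 2 * n - 1 - i)) = 0"
    if i: "i < 2 * n" for i
  proof -
    have "H $$ (i, i) + H $$ (2 * n - 1 - i, 2 * n - 1 - i) = 0"
      "H' $$ (i, i) + H' $$ (2 * n - 1 - i, 2 * n - 1 - i) = 0"
      using H H' i by (simp_all only: lie_torus_iff)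
    then show ?thesis by (simp add: add_eq_0_iff)
  qed
  with H H' show ?thesis
    by (auto simp: lie_torus_iff diagonal_mat_def index)
qed

lemma lie_torus_smult_closed:
  assumes H: "H \<in> lie_torus n"
  shows "c \<cdot>\<^sub>m H \<in> lie_torus n"
proof -
  have index: "(c \<cdot>\<^sub>m H) $$ (i, j) = c * H $$ (i, j)" if "i < 2 * n" "j < 2 * n" for i j
    using H that by (auto simp: lie_torus_iff)
  with H show ?thesis
    by (auto simp: lie_torus_iff diagonal_mat_def distrib_left[symmetric])
qed

lemma has_weight_index_product:
  assumes i: "i < 2 * n" and j: "j < 2 * n"
    and \<phi>: "\<phi> \<in> rep_ring n" "\<And>s. s \<in> torus n \<Longrightarrow> \<phi> s = s $$ (i, i) * s $$ (j, j)"
  shows "has_weight n \<phi> (\<lambda>H\<in>lie_torus n. H $$ (i, i) + H $$ (j, j))"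
  unfolding has_weight_def
proof (intro conjI allI impI)
  have "\<phi> (s * s') = \<phi> s * \<phi> s'" if s: "s \<in> torus n" "s' \<in> torus n" for s s'
    using i j \<phi>(2)[OF s(1)] \<phi>(2)[OF s(2)] \<phi>(2)[OF torus_mult_closed[OF s]]
    by (simp add: torus_mult_eq_mat_diag[OF s] mat_diag_index)
  moreover have "\<phi> s \<noteq> 0" if "s \<in> torus n" for s
    using that i j by (simp add: \<phi>(2) torus_index_nonzero)
  ultimately show "\<phi> \<in> torus_characters n"
    using \<phi>(1) by (auto simp: torus_characters_def)
  have dims: "dim_row H = 2 * n" "dim_col H = 2 * n" if "H \<in> lie_torus n" for H
    using that by (auto simp: lie_torus_iff)
  show "(\<lambda>H\<in>lie_torus n. H $$ (i, i) + H $$ (j, j)) \<in> lie_torus_dual n"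
    using i j dims
    by (auto simp: lie_torus_dual_def lie_torus_add_closed lie_torus_smult_closed distrib_left)
next
  fix \<gamma> H assume c: "curve_through_one (2 * n) (torus n) \<gamma> H"
  then have H: "H \<in> lie_torus n" by (auto simp: lie_algebra_def)
  have t: "\<gamma> u \<in> torus n" for u
    using c by (simp add: curve_through_one_def)
  have one: "\<gamma> 0 = 1\<^sub>m (2 * n)"
    using c by (simp add: curve_through_one_def)
  have "((\<lambda>u. \<gamma> u $$ (i, i) * \<gamma> u $$ (j, j)) has_vector_derivative
      \<gamma> 0 $$ (i, i) * H $$ (j, j) + H $$ (i, i) * \<gamma> 0 $$ (j, j)) (at 0)"
    using c i j by (intro has_vector_derivative_mult) (auto simp: curve_through_one_def)
  then show "((\<lambda>u. \<phi> (\<gamma> u)) has_vector_derivative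
      (\<lambda>H\<in>lie_torus n. H $$ (i, i) + H $$ (j, j)) H) (at 0)"
    using H i j by (simp add: \<phi>(2)[OF t] one add.commute)
qed

text \<open>
  The witness is the diagonal matrix with \<open>1\<close> at \<open>p\<close> and \<open>-1\<close> at its mirror: the sum can only
  cancel if \<open>q\<close> is that mirror.
\<close>

lemma index_sum_nonzero_on_lie_torus:
  assumes p: "p < 2 * n" and q: "q < 2 * n" and pq: "p + q + 1 \<noteq> 2 * n"
  shows "(\<lambda>H\<in>lie_torus n. H $$ (p, p) + H $$ (q, q)) \<noteq> (\<lambda>H\<in>lie_torus n. 0)"
proof
  define h :: "nat \<Rightarrow> complex" where
    "h i = (if i = p then 1 else if i = 2 * n - 1 - p then - 1 else 0)" for i
  have pr: "p \<noteq> 2 * n - 1 - p" using p by presburger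
  have "h i + h (2 * n - 1 - i) = 0" if i: "i < 2 * n" for i
  proof -
    have "2 * n - 1 - i = p \<longleftrightarrow> i = 2 * n - 1 - p" "2 * n - 1 - i = 2 * n - 1 - p \<longleftrightarrow> i = p"
      using i p by linarith+
    then show ?thesis using pr by (simp only: h_def) simp
  qed
  then have H: "mat_diag (2 * n) h \<in> lie_torus n"
    using curve_diag_exp[of n h] by (auto simp: lie_algebra_def)
  assume "(\<lambda>H\<in>lie_torus n. H $$ (p, p) + H $$ (q, q)) = (\<lambda>H\<in>lie_torus n. 0)"
  from fun_cong[OF this, of "mat_diag (2 * n) h"] have "h p + h q = 0"
    using H p q by (simp add: mat_diag_index)
  moreover have "q \<noteq> 2 * n - 1 - p" using p pq by linarith
  ultimately show False by (simp add: h_def split: if_splits)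
qed

lemma positive_root_and_character:
  assumes a: "1 \<le> a" and b: "1 \<le> b" and ab: "a + b \<le> 2 * n"
  defines "\<theta> \<equiv> (\<lambda>H\<in>lie_torus n. - t_weight n a H - t_weight n b H)"
  shows "has_weight n (\<lambda>s\<in>torus n. 1 / (t_char n a s * t_char n b s)) \<theta>"
    and "positive_root n \<theta>"
proof -
  define p q where "p = a - 1" and "q = b - 1"
  have p: "p < 2 * n" and q: "q < 2 * n" and pq: "p + q + 1 < 2 * n"
    using a b ab by (auto simp: p_def q_def)
  let ?p = "2 * n - 1 - p" and ?q = "2 * n - 1 - q"
  have p': "?p < 2 * n" and q': "?q < 2 * n" using p q by auto
  let ?\<phi> = "\<lambda>s\<in>torus n. 1 / (t_char n a s * t_char n b s)"
  have "- t_weight n a H - t_weight n b H = H $$ (?p, ?p) + H $$ (?q, ?q)"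
    if H: "H \<in> lie_torus n" for H
  proof -
    have "H $$ (p, p) + H $$ (?p, ?p) = 0" "H $$ (q, q) + H $$ (?q, ?q) = 0"
      using H p q by (simp_all only: lie_torus_iff)
    moreover have "t_weight n a H = H $$ (p, p)" "t_weight n b H = H $$ (q, q)"
      using H a b ab by (simp_all add: t_weight_eq_index p_def q_def)
    ultimately show ?thesis
      by (simp add: add_eq_0_iff)
  qed
  then have \<theta>: "\<theta> = (\<lambda>H\<in>lie_torus n. H $$ (?p, ?p) + H $$ (?q, ?q))"
    unfolding \<theta>_def by (rule restrict_ext)
  have \<phi>: "?\<phi> s = s $$ (?p, ?p) * s $$ (?q, ?q)" if s: "s \<in> torus n" for s
  proof -
    have "t_char n a s = s $$ (p, p)" "t_char n b s = s $$ (q, q)"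
      using s a b ab by (simp_all add: t_char_eq_index p_def q_def)
    moreover have "inverse (s $$ (p, p)) = s $$ (?p, ?p)" "inverse (s $$ (q, q)) = s $$ (?q, ?q)"
      using torus_index_inverse[OF s] p q by (simp_all only: inverse_unique)
    ultimately show ?thesis using s by (simp add: divide_inverse)
  qed
  show hw: "has_weight n ?\<phi> \<theta>"
    unfolding \<theta>
  proof (rule has_weight_index_product[OF p' q' _ \<phi>])
    show "?\<phi> \<in> rep_ring n"
      using a b ab by (intro inverse_t_char_product_in_rep_ring) auto
  qed
  have "\<theta> \<noteq> (\<lambda>H\<in>lie_torus n. 0)"
    unfolding \<theta> using pq by (intro index_sum_nonzero_on_lie_torus[OF p' q']) linarith
  moreover have "adjoint_action s (root_vector n p q) = ?\<phi> s \<cdot>\<^sub>m root_vector n p q"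
    if "s \<in> torus n" for s
    using adjoint_action_root_vector[OF that p q] unfolding \<phi>[OF that] .
  ultimately show "positive_root n \<theta>"
    unfolding positive_root_def weight_on_def
    using hw root_vector_in_lie_borel_minus[OF p q pq] root_vector_nonzero[OF p q] by blast
qed

section \<open>Positions of entries in an index set and its complement\<close>

lemma elt_rank:
  assumes A: "finite A" and k: "1 \<le> k" "k \<le> card A"
  shows "elt A k \<in> A" and "card {y \<in> A. y \<le> elt A k} = k"
proof -
  define l where "l = sorted_list_of_set A"
  have l: "sorted_wrt (<) l" "set l = A" "length l = card A"
    using A by (simp_all add: l_def)
  have mono: "l ! i \<le> l ! j \<longleftrightarrow> i \<le> j" if "i < card A" "j < card A" for i j
    using that l sorted_wrt_nth_less[OF l(1), of i j] sorted_wrt_nth_less[OF l(1), of j i]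
    by (metis le_less linorder_not_le order_less_imp_le)
  have elt: "elt A k = l ! (k - 1)" by (simp add: elt_def l_def)
  show "elt A k \<in> A"
    unfolding elt using nth_mem[of "k - 1" l] k l(2,3) by simp
  have "A = (!) l ` {..<card A}"
    using l by (metis atLeast_upt list.set_map map_nth)
  then have "{y \<in> A. y \<le> elt A k} = (!) l ` {i. i < card A \<and> l ! i \<le> l ! (k - 1)}"
    unfolding elt by auto
  also have "{i. i < card A \<and> l ! i \<le> l ! (k - 1)} = {..<k}"
    using k mono by auto
  also have "card ((!) l ` {..<k}) = k"
  proof -
    have "inj_on ((!) l) {..<k}"
      using k l(3) A by (auto simp: inj_on_def l_def nth_eq_iff_index_eq)
    then show ?thesis by (simp add: card_image)
  qed
  finally show "card {y \<in> A. y \<le> elt A k} = k" .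
qed

lemma elt_le_if_card_ge:
  assumes A: "finite A" and k: "1 \<le> k" "k \<le> card {y \<in> A. y \<le> m}"
  shows "elt A k \<le> m" and "elt A k \<in> A"
proof -
  have "card {y \<in> A. y \<le> m} \<le> card A"
    using A by (intro card_mono) auto
  with k have k': "k \<le> card A" by linarith
  note e = elt_rank[OF A k(1) k']
  show "elt A k \<in> A" by (rule e)
  show "elt A k \<le> m"
  proof (rule ccontr)
    assume "\<not> elt A k \<le> m"
    then have "{y \<in> A. y \<le> m} \<subset> {y \<in> A. y \<le> elt A k}"
      using e(1) by (auto intro: order_trans)
    then have "card {y \<in> A. y \<le> m} < card {y \<in> A. y \<le> elt A k}"
      using A by (intro psubset_card_mono) auto
    with e(2) k show False by simp
  qed
qed

text \<open>
  With \<open>m = \<beta>(n + 1 - x)\<close>, counting the elements of \<open>\<beta>'\<close> up to \<open>m\<close> and up to \<open>bar m\<close> gives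
  \<open>\<beta>'(z) < m\<close> and \<open>\<beta>'(x) \<le> bar m\<close>; adding the two bounds eliminates \<open>m\<close>.
\<close>

lemma elt_compl_sum_le:
  assumes \<beta>: "\<beta> \<in> index_sets n" and x: "1 \<le> x" "x \<le> n"
    and z: "1 \<le> z" "z \<le> elt \<beta> (n + 1 - x) - (n + 1 - x)"
  shows "1 \<le> elt (index_compl n \<beta>) x" and "1 \<le> elt (index_compl n \<beta>) z"
    and "elt (index_compl n \<beta>) x + elt (index_compl n \<beta>) z \<le> 2 * n"
proof -
  define \<beta>' where "\<beta>' = index_compl n \<beta>"
  define m where "m = elt \<beta> (n + 1 - x)"
  have sub: "\<beta> \<subseteq> {1..2 * n}" and card: "card \<beta> = n"
    and bar: "\<And>k. k \<in> {1..2 * n} \<Longrightarrow> (k \<in> \<beta>) \<noteq> (bar n k \<in> \<beta>)"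
    using \<beta> by (auto simp: index_sets_def)
  have fin: "finite \<beta>" using sub finite_subset by blast
  have fin': "finite \<beta>'" by (simp add: \<beta>'_def index_compl_def)
  have m: "m \<in> \<beta>" "card {y \<in> \<beta>. y \<le> m} = n + 1 - x"
    unfolding m_def using elt_rank[OF fin, of "n + 1 - x"] x card by auto
  have m2: "1 \<le> m" "m \<le> 2 * n" using m(1) sub by auto

  have "{y \<in> \<beta>'. y \<le> m} = {1..m} - {y \<in> \<beta>. y \<le> m}"
    using m2 by (auto simp: \<beta>'_def index_compl_def)
  moreover have "{y \<in> \<beta>. y \<le> m} \<subseteq> {1..m}" using sub by auto
  ultimately have "card {y \<in> \<beta>'. y \<le> m} = m - (n + 1 - x)"
    using m(2) fin by (simp add: card_Diff_subset)
  then have ez: "elt \<beta>' z \<le> m" "elt \<beta>' z \<in> \<beta>'"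
    using elt_le_if_card_ge[OF fin' z(1), of m] z(2) by (simp_all add: m_def)
  have "elt \<beta>' z \<noteq> m" using ez(2) m(1) by (auto simp: \<beta>'_def index_compl_def)
  with ez(1) have z_less: "elt \<beta>' z < m" by simp

  have "bij_betw (bar n) {y \<in> \<beta>. m \<le> y} {y \<in> \<beta>'. y \<le> bar n m}"
  proof (rule bij_betw_byWitness[where f' = "bar n"])
    show "\<forall>y\<in>{y \<in> \<beta>. m \<le> y}. bar n (bar n y) = y"
      using sub by (auto simp: bar_def)
    show "\<forall>y\<in>{y \<in> \<beta>'. y \<le> bar n m}. bar n (bar n y) = y"
      by (auto simp: \<beta>'_def index_compl_def bar_def)
    show "bar n ` {y \<in> \<beta>. m \<le> y} \<subseteq> {y \<in> \<beta>'. y \<le> bar n m}"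
    proof
      fix w assume "w \<in> bar n ` {y \<in> \<beta>. m \<le> y}"
      then obtain y where y: "y \<in> \<beta>" "m \<le> y" "w = bar n y" by auto
      then have "y \<in> {1..2 * n}" using sub by auto
      with y bar[of y] show "w \<in> {y \<in> \<beta>'. y \<le> bar n m}"
        by (auto simp: \<beta>'_def index_compl_def) (auto simp: bar_def)
    qed
    show "bar n ` {y \<in> \<beta>'. y \<le> bar n m} \<subseteq> {y \<in> \<beta>. m \<le> y}"
    proof
      fix w assume "w \<in> bar n ` {y \<in> \<beta>'. y \<le> bar n m}"
      then obtain y where y: "y \<in> {1..2 * n}" "y \<notin> \<beta>" "y \<le> bar n m" "w = bar n y"
        by (auto simp: \<beta>'_def index_compl_def)
      with bar[of y] m2 show "w \<in> {y \<in> \<beta>. m \<le> y}"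
        by (auto simp: bar_def)
    qed
  qed
  then have "card {y \<in> \<beta>'. y \<le> bar n m} = card {y \<in> \<beta>. m \<le> y}"
    by (simp add: bij_betw_same_card)
  moreover have "x \<le> card {y \<in> \<beta>. m \<le> y}"
  proof -
    have "\<beta> = ({y \<in> \<beta>. y \<le> m} - {m}) \<union> {y \<in> \<beta>. m \<le> y}" by auto
    then have "n \<le> card ({y \<in> \<beta>. y \<le> m} - {m}) + card {y \<in> \<beta>. m \<le> y}"
      using card card_Un_le by metis
    moreover have "card ({y \<in> \<beta>. y \<le> m} - {m}) = n - x"
      using m fin x by (simp add: card_Diff_singleton)
    ultimately show ?thesis using x by simp
  qed
  ultimately have ex: "elt \<beta>' x \<le> bar n m" "elt \<beta>' x \<in> \<beta>'"
    using elt_le_if_card_ge[OF fin' x(1), of "bar n m"] by simp_all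
  show "1 \<le> elt (index_compl n \<beta>) x" "1 \<le> elt (index_compl n \<beta>) z"
    using ex(2) ez(2) by (auto simp: \<beta>'_def index_compl_def)
  show "elt (index_compl n \<beta>) x + elt (index_compl n \<beta>) z \<le> 2 * n"
    using ex(1) z_less m2 by (simp add: \<beta>'_def bar_def)
qed

text \<open>
  The set of admissible \<open>l\<close> in the definition of \<open>\<rho>\<close> is nonempty (it contains 1) and bounded by \<open>n\<close>,
  since parts beyond the end are 0; so the greatest such \<open>l\<close> is attained.
\<close>

lemma length_sigma_map_le:
  assumes "n \<ge> 1" and "card \<beta> = n"
  shows "length (sigma_map \<beta>) \<le> n"
proof -
  let ?P = "\<lambda>l. 1 \<le> l \<and> l \<le> part (pi_map \<beta>) l + 1"
  have le: "l \<le> n" if "?P l" for l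
    using that assms by (cases "l \<le> n") (auto simp: part_def pi_map_def)
  have "?P (GREATEST l. ?P l)"
    by (rule GreatestI_nat[of ?P 1 n]) (use le in auto)
  then show ?thesis
    using le by (simp add: sigma_map_def rho_map_def)
qed

lemma part_map_upt: "1 \<le> x \<Longrightarrow> x \<le> l \<Longrightarrow> part (map f [1..<l + 1]) x = f x"
  by (simp add: part_def del: upt_Suc)

lemma part_sigma_map:
  assumes "card \<beta> = n" and "1 \<le> x" and "x \<le> length (sigma_map \<beta>)" and "x \<le> n"
  shows "part (sigma_map \<beta>) x = elt \<beta> (n + 1 - x) - (n + 1 - x) + 1 - x"
proof -
  have "part (sigma_map \<beta>) x = part (pi_map \<beta>) x + 1 - x"
    using assms(2,3) unfolding sigma_map_def rho_map_def by (subst part_map_upt) (simp_all del: upt_Suc)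
  also have "part (pi_map \<beta>) x = elt \<beta> (n + 1 - x) - (n + 1 - x)"
  proof -
    have "rev [1..<n + 1] ! (x - 1) = n + 1 - x"
      using assms(2,4) by (subst rev_nth) (simp_all del: upt_Suc)
    moreover have "part (pi_map \<beta>) x = (\<lambda>i. elt \<beta> i - i) (rev [1..<n + 1] ! (x - 1))"
      using assms(1,2,4) by (simp add: part_def pi_map_def del: upt_Suc)
    ultimately show ?thesis by (simp only:)
  qed
  finally show ?thesis .
qed

text \<open>
  The excess \<open>c - r \<ge> 0\<close> of a box in a shifted diagram gives \<open>z(x) \<ge> x\<close>. This
  rules out a truncated subtraction in \<open>part_sigma_map\<close>, so that \<open>z(x) \<le> \<mu>\<^sub>x + x - 1\<close> becomes a bound
  by the corresponding part of \<open>\<pi>(\<beta>)\<close>.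
\<close>

lemma entry_compl_sum_le:
  assumes n: "n \<ge> 1" and \<beta>: "\<beta> \<in> index_sets n"
    and S: "set_valued_shifted_tableau lam S" "on_partition (sigma_map \<beta>) lam S"
    and x: "is_entry lam S r c x"
  shows "1 \<le> elt (index_compl n \<beta>) x" and "1 \<le> elt (index_compl n \<beta>) (z_entry r c x)"
    and "elt (index_compl n \<beta>) x + elt (index_compl n \<beta>) (z_entry r c x) \<le> 2 * n"
proof -
  have card: "card \<beta> = n" using \<beta> by (simp add: index_sets_def)
  have x1: "1 \<le> x" and rc: "r \<le> c"
    using x S(1) by (auto simp: is_entry_def set_valued_shifted_tableau_def shifted_diagram_def)
  have len: "x \<le> length (sigma_map \<beta>)"
    and z: "z_entry r c x \<le> part (sigma_map \<beta>) x + x - 1"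
    using x S(2) by (auto simp: on_partition_def)
  have xn: "x \<le> n" using len length_sigma_map_le[OF n card] by linarith
  have xz: "x \<le> z_entry r c x" using rc by (simp add: z_entry_def)
  have "z_entry r c x \<le> elt \<beta> (n + 1 - x) - (n + 1 - x)"
    using z xz x1 unfolding part_sigma_map[OF card x1 len xn] by linarith
  then show "1 \<le> elt (index_compl n \<beta>) x" "1 \<le> elt (index_compl n \<beta>) (z_entry r c x)"
    "elt (index_compl n \<beta>) x + elt (index_compl n \<beta>) (z_entry r c x) \<le> 2 * n"
    using elt_compl_sum_le[OF \<beta> x1 xn, of "z_entry r c x"] x1 xz by auto
qed

section \<open>Factors at tableau entries\<close>

theorem mainTheorem2:
  fixes n :: nat and \<alpha> \<beta> :: "nat set" and lam mu :: "nat list"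
  assumes "n \<ge> 1"
    and "\<alpha> \<in> index_sets n" and "\<beta> \<in> index_sets n"
    and "lam = sigma_map \<alpha>" and "mu = sigma_map \<beta>"
  shows
    "(\<forall>S. set_valued_shifted_tableau lam S \<and> semistandard lam S \<and> on_partition mu lam S \<longrightarrow>
        (\<forall>r c x. is_entry lam S r c x \<longrightarrow>
          (let \<beta>' = index_compl n \<beta>;
               factor = (\<lambda>s\<in>torus n.
                 1 / (t_char n (elt \<beta>' x) s * t_char n (elt \<beta>' (z_entry r c x)) s) - 1)
           in factor \<in> rep_ring n \<and>
              (\<exists>\<theta>. positive_root n \<theta> \<and> factor = (\<lambda>s\<in>torus n. exp_weight n \<theta> s - 1)))))
     \<and>
     (\<forall>S. young_shifted_tableau lam S \<and> semistandard lam S \<and> on_partition mu lam S \<longrightarrow>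
        (\<forall>r c x. is_entry lam S r c x \<longrightarrow>
          (let \<beta>' = index_compl n \<beta>
           in positive_root n (\<lambda>H\<in>lie_torus n.
                - t_weight n (elt \<beta>' x) H - t_weight n (elt \<beta>' (z_entry r c x)) H))))"
proof (intro conjI allI impI)
  fix S r c x
  assume S: "set_valued_shifted_tableau lam S \<and> semistandard lam S \<and> on_partition mu lam S"
    and x: "is_entry lam S r c x"
  let ?a = "elt (index_compl n \<beta>) x" and ?b = "elt (index_compl n \<beta>) (z_entry r c x)"
  let ?\<phi> = "\<lambda>s\<in>torus n. 1 / (t_char n ?a s * t_char n ?b s)"
  let ?\<theta> = "\<lambda>H\<in>lie_torus n. - t_weight n ?a H - t_weight n ?b H"
  have le: "1 \<le> ?a" "1 \<le> ?b" "?a + ?b \<le> 2 * n"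
    using entry_compl_sum_le[of n \<beta> lam S r c x] assms S x by auto
  have w: "has_weight n ?\<phi> ?\<theta>" and root: "positive_root n ?\<theta>"
    by (rule positive_root_and_character[OF le])+
  have factor: "(\<lambda>s\<in>torus n. 1 / (t_char n ?a s * t_char n ?b s) - 1) = (\<lambda>s\<in>torus n. ?\<phi> s - 1)"
    by (auto intro!: restrict_ext)
  have "(\<lambda>s\<in>torus n. ?\<phi> s - (\<lambda>s\<in>torus n. 1) s) \<in> rep_ring n"
    using w unfolding has_weight_def torus_characters_def
    by (intro rep_ring_diff one_in_rep_ring) blast
  moreover have "(\<lambda>s\<in>torus n. ?\<phi> s - (\<lambda>s\<in>torus n. 1) s) = (\<lambda>s\<in>torus n. ?\<phi> s - 1)"
    by (auto intro!: restrict_ext)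
  ultimately have "(\<lambda>s\<in>torus n. ?\<phi> s - 1) \<in> rep_ring n" by simp
  moreover have "(\<lambda>s\<in>torus n. ?\<phi> s - 1) = (\<lambda>s\<in>torus n. exp_weight n ?\<theta> s - 1)"
    unfolding exp_weight_eq[OF w] ..
  ultimately show "let \<beta>' = index_compl n \<beta>;
      factor = (\<lambda>s\<in>torus n.
        1 / (t_char n (elt \<beta>' x) s * t_char n (elt \<beta>' (z_entry r c x)) s) - 1)
    in factor \<in> rep_ring n \<and>
      (\<exists>\<theta>. positive_root n \<theta> \<and> factor = (\<lambda>s\<in>torus n. exp_weight n \<theta> s - 1))"
    unfolding Let_def factor using root by blast
next
  fix S r c x
  assume S: "young_shifted_tableau lam S \<and> semistandard lam S \<and> on_partition mu lam S"
    and x: "is_entry lam S r c x"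
  let ?a = "elt (index_compl n \<beta>) x" and ?b = "elt (index_compl n \<beta>) (z_entry r c x)"
  have "1 \<le> ?a" "1 \<le> ?b" "?a + ?b \<le> 2 * n"
    using entry_compl_sum_le[of n \<beta> lam S r c x] assms S x by (auto simp: young_shifted_tableau_def)
  then show "let \<beta>' = index_compl n \<beta>
    in positive_root n (\<lambda>H\<in>lie_torus n.
         - t_weight n (elt \<beta>' x) H - t_weight n (elt \<beta>' (z_entry r c x)) H)"
    unfolding Let_def by (rule positive_root_and_character(2))
qed

end
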